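(* Let $S\subset\mathbb{R}^3$ be a smooth surface and let $x:U\subset\mathbb{R}^2\to S\subset\mathbb{R}^3$ be a parameterization of $S$ by isothermal coordinates $(u,v)\in U$. Put $\lambda=(x_u,x_u)$ and $n=\lambda^{-1}(x_u\times x_v)$, and let $h_{ij}$ ($i,j=1,2$) be the coefficients of the second fundamental form of $S$ with respect to $x$ and $n$. Let $y:U\to\mathbb{R}^3$ be a Darboux rotation field of $S$, i.e. $y_u\times x_v=y_v\times x_u$ everywhere in $U$. Then $y$ also satisfies the following relations in $U$: $$(y_u,n)=0,$$ $$(y_v,n)=0,$$ $$(y_u,x_u)+(y_v,x_v)=0,$$ $$h_{21}(y_u,x_u)+h_{22}(y_u,x_v)-h_{11}(y_v,x_u)-h_{12}(y_v,x_v)=0.$$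
   Context: Conventions. "Smooth" means differentiable as many times as needed (one may take $C^\infty$). Surfaces are connected; $U$ is a domain (connected open set) in $\mathbb{R}^2$. Subscripts $u,v$ denote partial derivatives; $(a,b)$ is the dot product and $a\times b$ the cross product of $a,b\in\mathbb{R}^3$. Isothermal coordinates: the parameterization $x$ satisfies $(x_u,x_u)=(x_v,x_v)=\lambda$ and $(x_u,x_v)=0$ on $U$, where $\lambda:U\to(0,+\infty)$ is a smooth function. The unit normal is $n=\lambda^{-1}(x_u\times x_v)$. Second fundamental form: $h_{11}=(x_{uu},n)$, $h_{12}=h_{21}=(x_{uv},n)$, $h_{22}=(x_{vv},n)$. Darboux rotation field of $S$ (in the parameterization $x$): any smooth map $y:U\to\mathbb{R}^3$ with $y_u\times x_v=y_v\times x_u$ on $U$. *)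

theory Defs
  imports "HOL-Analysis.Analysis"
begin

unbundle cross3_syntax

section \<open>Smooth maps and partial derivatives\<close>

text \<open>The following notion is meant for open \<open>S\<close>: differentiability is required with respect to
  full neighbourhoods of the points of \<open>S\<close>, and values of \<open>f\<close> outside \<open>S\<close> are irrelevant.\<close>

primrec higher_differentiable_on ::
    "'a::real_normed_vector set \<Rightarrow> ('a \<Rightarrow> 'b::real_normed_vector) \<Rightarrow> nat \<Rightarrow> bool" where
  "higher_differentiable_on S f 0 \<longleftrightarrow> continuous_on S f"
| "higher_differentiable_on S f (Suc k) \<longleftrightarrow>
     (\<forall>p\<in>S. f differentiable (at p)) \<and>
     (\<forall>v. higher_differentiable_on S (\<lambda>p. frechet_derivative f (at p) v) k)"

definition smooth_on :: "'a::real_normed_vector set \<Rightarrow> ('a \<Rightarrow> 'b::real_normed_vector) \<Rightarrow> bool" where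
  "smooth_on S f \<longleftrightarrow> (\<forall>k. higher_differentiable_on S f k)"

definition partial :: "2 \<Rightarrow> (real^2 \<Rightarrow> 'b::real_normed_vector) \<Rightarrow> real^2 \<Rightarrow> 'b" where
  "partial i f p = vector_derivative (\<lambda>t. f (p + t *\<^sub>R axis i 1)) (at 0)"

lemma partial_eq_frechet_derivative:
  assumes "f differentiable (at p)"
  shows "partial i f p = frechet_derivative f (at p) (axis i 1)"
proof -
  let ?g = "\<lambda>t::real. p + t *\<^sub>R axis i (1::real)"
  have g: "(?g has_derivative (\<lambda>t. t *\<^sub>R axis i 1)) (at 0)"
    by (auto intro!: derivative_eq_intros)
  have f: "(f has_derivative frechet_derivative f (at p)) (at (?g 0))"
    using assms by (simp add: frechet_derivative_works)
  interpret D: linear "frechet_derivative f (at p)"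
    using assms by (rule linear_frechet_derivative)
  have "((\<lambda>t. f (?g t)) has_derivative (\<lambda>t. t *\<^sub>R frechet_derivative f (at p) (axis i 1))) (at 0)"
    using has_derivative_compose[OF g f] by (simp add: D.scaleR)
  then have "((\<lambda>t. f (?g t)) has_vector_derivative frechet_derivative f (at p) (axis i 1)) (at 0)"
    by (simp add: has_vector_derivative_def)
  then show ?thesis
    unfolding partial_def by (rule vector_derivative_at)
qed

text \<open>The coordinates are \<open>u = p $ 1\<close> and \<open>v = p $ 2\<close>.\<close>

abbreviation partial_u :: "(real^2 \<Rightarrow> 'b::real_normed_vector) \<Rightarrow> real^2 \<Rightarrow> 'b" where
  "partial_u \<equiv> partial 1"

abbreviation partial_v :: "(real^2 \<Rightarrow> 'b::real_normed_vector) \<Rightarrow> real^2 \<Rightarrow> 'b" where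
  "partial_v \<equiv> partial 2"

section \<open>Surfaces and their parameterizations\<close>

text \<open>A parameterization of \<open>S\<close> is a smooth immersion of a plane domain that is a homeomorphism
  onto a relatively open subset of \<open>S\<close>; it is not required to cover \<open>S\<close>.\<close>

definition parameterization :: "(real^2) set \<Rightarrow> (real^2 \<Rightarrow> real^3) \<Rightarrow> (real^3) set \<Rightarrow> bool" where
  "parameterization U x S \<longleftrightarrow>
     open U \<and> connected U \<and> U \<noteq> {} \<and>
     smooth_on U x \<and>
     (\<forall>p\<in>U. inj (frechet_derivative x (at p))) \<and>
     openin (top_of_set S) (x ` U) \<and>
     (\<exists>g. homeomorphism U (x ` U) x g)"

definition smooth_surface :: "(real^3) set \<Rightarrow> bool" where
  "smooth_surface S \<longleftrightarrow>
     S \<noteq> {} \<and> connected S \<and> (\<forall>q\<in>S. \<exists>U x. parameterization U x S \<and> q \<in> x ` U)"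

definition conformal_factor :: "(real^2 \<Rightarrow> real^3) \<Rightarrow> real^2 \<Rightarrow> real" where
  "conformal_factor x p = partial_u x p \<bullet> partial_u x p"

definition isothermal_on :: "(real^2) set \<Rightarrow> (real^2 \<Rightarrow> real^3) \<Rightarrow> bool" where
  "isothermal_on U x \<longleftrightarrow>
     smooth_on U (conformal_factor x) \<and>
     (\<forall>p\<in>U. 0 < conformal_factor x p \<and>
            partial_v x p \<bullet> partial_v x p = conformal_factor x p \<and>
            partial_u x p \<bullet> partial_v x p = 0)"

text \<open>The normalization is correct for isothermal \<open>x\<close>, where the conformal factor equals the norm
  of the cross product.\<close>

definition unit_normal :: "(real^2 \<Rightarrow> real^3) \<Rightarrow> real^2 \<Rightarrow> real^3" where
  "unit_normal x p = inverse (conformal_factor x p) *\<^sub>R (partial_u x p \<times> partial_v x p)"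

section \<open>Second fundamental form\<close>

definition h11 :: "(real^2 \<Rightarrow> real^3) \<Rightarrow> real^2 \<Rightarrow> real" where
  "h11 x p = partial_u (partial_u x) p \<bullet> unit_normal x p"

definition h12 :: "(real^2 \<Rightarrow> real^3) \<Rightarrow> real^2 \<Rightarrow> real" where
  "h12 x p = partial_v (partial_u x) p \<bullet> unit_normal x p"

definition h21 :: "(real^2 \<Rightarrow> real^3) \<Rightarrow> real^2 \<Rightarrow> real" where
  "h21 x p = h12 x p"

definition h22 :: "(real^2 \<Rightarrow> real^3) \<Rightarrow> real^2 \<Rightarrow> real" where
  "h22 x p = partial_v (partial_v x) p \<bullet> unit_normal x p"

section \<open>Darboux rotation fields\<close>

definition darboux_rotation_field ::
    "(real^2) set \<Rightarrow> (real^2 \<Rightarrow> real^3) \<Rightarrow> (real^2 \<Rightarrow> real^3) \<Rightarrow> bool" where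
  "darboux_rotation_field U x y \<longleftrightarrow>
     smooth_on U y \<and>
     (\<forall>p\<in>U. partial_u y p \<times> partial_v x p = partial_v y p \<times> partial_u x p)"

end

theory Submission
  imports Defs
begin

text \<open>
  Taking the inner product of the Darboux equation with \<open>x\<^sub>u\<close>, \<open>x\<^sub>v\<close> and \<open>n\<close> gives the first three
  relations. For the fourth one, differentiate \<open>(y\<^sub>u, x\<^sub>u \<times> x\<^sub>v) = 0\<close> with respect to \<open>v\<close> and
  \<open>(y\<^sub>v, x\<^sub>u \<times> x\<^sub>v) = 0\<close> with respect to \<open>u\<close>, and subtract: the terms with \<open>y\<^sub>u\<^sub>v\<close> cancel, and
  expanding the tangential vectors \<open>y\<^sub>u\<close>, \<open>y\<^sub>v\<close> in the orthogonal frame \<open>x\<^sub>u\<close>, \<open>x\<^sub>v\<close> leaves exactly the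
  relation. The symmetry of second derivatives is obtained from the mean value theorem applied
  twice to a second difference.
\<close>

section \<open>Symmetry of second derivatives\<close>

text \<open>One mean value step along \<open>a\<close> turns the second difference into a difference
  of first derivatives, a second one along \<open>b\<close> into a second derivative. The second
  difference is symmetric in \<open>a\<close> and \<open>b\<close>, so exchanging them compares the
  two mixed derivatives.\<close>

lemma second_difference_mvt:
  fixes g :: "'a::real_normed_vector \<Rightarrow> real"
  assumes h: "0 < h"
    and g': "\<And>q. q \<in> B \<Longrightarrow> (g has_derivative g' q) (at q)"
    and g'': "\<And>q. q \<in> B \<Longrightarrow> ((\<lambda>r. g' r a) has_derivative g'' q) (at q)"
    and B: "\<And>s t. \<lbrakk>0 \<le> s; s \<le> h; 0 \<le> t; t \<le> h\<rbrakk> \<Longrightarrow> p + s *\<^sub>R a + t *\<^sub>R b \<in> B"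
  obtains s t where "0 < s" "s < h" "0 < t" "t < h"
    "g (p + h *\<^sub>R a + h *\<^sub>R b) - g (p + h *\<^sub>R a) - g (p + h *\<^sub>R b) + g p
       = h\<^sup>2 * g'' (p + s *\<^sub>R a + t *\<^sub>R b) b"
proof -
  have line: "((\<lambda>r. f (c + r *\<^sub>R d)) has_real_derivative f' d) (at s)"
    if "(f has_derivative f') (at (c + s *\<^sub>R d))"
    for f f' and c d :: 'a and s :: real
  proof -
    have "((\<lambda>r. c + r *\<^sub>R d) has_derivative (\<lambda>r. r *\<^sub>R d)) (at s)"
      by (auto intro!: derivative_eq_intros)
    from has_derivative_compose[OF this that]
    have "((\<lambda>r. f (c + r *\<^sub>R d)) has_derivative (\<lambda>r. f' (r *\<^sub>R d))) (at s)" .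
    moreover have "linear f'"
      using that by (rule has_derivative_linear)
    ultimately show ?thesis
      by (simp add: has_field_derivative_def linear_cmul mult.commute[of _ "f' d"])
  qed
  define \<phi> where "\<phi> s = g (p + s *\<^sub>R a + h *\<^sub>R b) - g (p + s *\<^sub>R a)" for s
  have 1: "(\<phi> has_real_derivative g' (p + s *\<^sub>R a + h *\<^sub>R b) a - g' (p + s *\<^sub>R a) a) (at s)"
    if "0 \<le> s" "s \<le> h" for s
  proof -
    have "p + h *\<^sub>R b + s *\<^sub>R a \<in> B" "p + s *\<^sub>R a \<in> B"
      using B[of s h] B[of s 0] that h by (simp_all add: ac_simps)
    then have "((\<lambda>s. g (p + h *\<^sub>R b + s *\<^sub>R a) - g (p + s *\<^sub>R a)) has_real_derivative
        g' (p + h *\<^sub>R b + s *\<^sub>R a) a - g' (p + s *\<^sub>R a) a) (at s)"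
      by (intro DERIV_diff line g')
    then show ?thesis
      unfolding \<phi>_def by (simp add: ac_simps)
  qed
  \<comment> \<open>The increment of \<open>\<phi>\<close> over \<open>[0, h]\<close> is exactly the
    second difference.\<close>
  obtain s where s: "0 < s" "s < h"
    and \<phi>: "\<phi> h - \<phi> 0 = (h - 0) * (g' (p + s *\<^sub>R a + h *\<^sub>R b) a - g' (p + s *\<^sub>R a) a)"
    using MVT2[OF h 1] by blast
  have 2: "((\<lambda>t. g' (p + s *\<^sub>R a + t *\<^sub>R b) a) has_real_derivative
      g'' (p + s *\<^sub>R a + t *\<^sub>R b) b) (at t)" if "0 \<le> t" "t \<le> h" for t
    by (rule line[where f = "\<lambda>r. g' r a"], rule g'', rule B) (use s that in auto)
  obtain t where t: "0 < t" "t < h"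
    and "g' (p + s *\<^sub>R a + h *\<^sub>R b) a - g' (p + s *\<^sub>R a + 0 *\<^sub>R b) a
      = (h - 0) * g'' (p + s *\<^sub>R a + t *\<^sub>R b) b"
    using MVT2[OF h 2] by blast
  with \<phi> have "\<phi> h - \<phi> 0 = h\<^sup>2 * g'' (p + s *\<^sub>R a + t *\<^sub>R b) b"
    by (simp add: power2_eq_square)
  with s t show thesis
    by (intro that[of s t]) (simp_all add: \<phi>_def)
qed

text \<open>Over a small parallelogram at \<open>p\<close>, a single second difference equals
  \<open>h\<^sup>2\<close> times either mixed derivative, each taken at some nearby point. By
  continuity the two cannot differ at \<open>p\<close>.\<close>

lemma symmetric_second_derivative_real:
  fixes g :: "'a::real_normed_vector \<Rightarrow> real"
  assumes S: "open S" "p \<in> S"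
    and g': "\<And>q. q \<in> S \<Longrightarrow> (g has_derivative g' q) (at q)"
    and ga: "\<And>q. q \<in> S \<Longrightarrow> ((\<lambda>r. g' r a) has_derivative ga q) (at q)"
    and gb: "\<And>q. q \<in> S \<Longrightarrow> ((\<lambda>r. g' r b) has_derivative gb q) (at q)"
    and cont: "continuous_on S (\<lambda>q. ga q b)" "continuous_on S (\<lambda>q. gb q a)"
  shows "ga p b = gb p a"
proof (rule ccontr)
  assume neq: "ga p b \<noteq> gb p a"
  \<comment> \<open>Half the gap: numbers less than \<open>e\<close> away from \<open>ga p b\<close>
    and \<open>gb p a\<close> respectively cannot coincide.\<close>
  define e where "e = \<bar>ga p b - gb p a\<bar> / 2"
  have e: "0 < e"
    using neq by (simp add: e_def)
  have "isCont (\<lambda>q. ga q b) p" "isCont (\<lambda>q. gb q a) p"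
    using cont S by (simp_all add: continuous_on_eq_continuous_at)
  then have "\<forall>\<^sub>F q in nhds p. dist (ga q b) (ga p b) < e" "\<forall>\<^sub>F q in nhds p. dist (gb q a) (gb p a) < e"
    using e by (auto simp: isCont_def tendsto_at_iff_tendsto_nhds[of "\<lambda>q. ga q b"]
        tendsto_at_iff_tendsto_nhds[of "\<lambda>q. gb q a"] dest: tendstoD)
  moreover have "\<forall>\<^sub>F q in nhds p. q \<in> S"
    using S by (rule eventually_nhds_in_open)
  ultimately have "\<forall>\<^sub>F q in nhds p. q \<in> S \<and> dist (ga q b) (ga p b) < e \<and> dist (gb q a) (gb p a) < e"
    by eventually_elim simp
  then obtain d where d: "0 < d"
    and near: "\<And>q. dist q p < d \<Longrightarrow> q \<in> S \<and> dist (ga q b) (ga p b) < e \<and> dist (gb q a) (gb p a) < e"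
    by (auto simp: eventually_nhds_metric)
  \<comment> \<open>This keeps the parallelogram spanned by \<open>h *\<^sub>R a\<close> and
    \<open>h *\<^sub>R b\<close> at \<open>p\<close> inside the ball of radius \<open>d\<close>; the
    summand 1 makes the denominator positive and the estimate strict.\<close>
  define h where "h = d / (norm a + norm b + 1)"
  have pos: "0 < norm a + norm b + 1"
    by (simp add: add_nonneg_pos)
  have h: "0 < h"
    using d pos by (simp add: h_def)
  have close: "dist (p + s *\<^sub>R a + t *\<^sub>R b) p < d" if "0 \<le> s" "s \<le> h" "0 \<le> t" "t \<le> h" for s t
  proof -
    have "dist (p + s *\<^sub>R a + t *\<^sub>R b) p = norm (s *\<^sub>R a + t *\<^sub>R b)"
      by (simp add: dist_norm add.assoc)
    also have "\<dots> \<le> s * norm a + t * norm b"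
      using norm_triangle_ineq[of "s *\<^sub>R a" "t *\<^sub>R b"] that by simp
    also have "\<dots> \<le> h * norm a + h * norm b"
      using that by (intro add_mono mult_right_mono) auto
    also have "\<dots> < h * (norm a + norm b + 1)"
      using h by (simp add: algebra_simps)
    also have "\<dots> = d"
      using pos by (simp add: h_def)
    finally show ?thesis .
  qed
  obtain s t where st: "0 < s" "s < h" "0 < t" "t < h"
    and 1: "g (p + h *\<^sub>R a + h *\<^sub>R b) - g (p + h *\<^sub>R a) - g (p + h *\<^sub>R b) + g p
       = h\<^sup>2 * ga (p + s *\<^sub>R a + t *\<^sub>R b) b"
    by (rule second_difference_mvt[OF h g' ga, of S p b]) (use near close in auto)
  have close': "dist (p + s *\<^sub>R b + t *\<^sub>R a) p < d" if "0 \<le> s" "s \<le> h" "0 \<le> t" "t \<le> h" for s t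
    using close[of t s] that by (simp add: ac_simps)
  obtain s' t' where st': "0 < s'" "s' < h" "0 < t'" "t' < h"
    and 2: "g (p + h *\<^sub>R b + h *\<^sub>R a) - g (p + h *\<^sub>R b) - g (p + h *\<^sub>R a) + g p
       = h\<^sup>2 * gb (p + s' *\<^sub>R b + t' *\<^sub>R a) a"
    by (rule second_difference_mvt[OF h g' gb, of S p a]) (use near close' in auto)
  have "h\<^sup>2 * ga (p + s *\<^sub>R a + t *\<^sub>R b) b = h\<^sup>2 * gb (p + s' *\<^sub>R b + t' *\<^sub>R a) a"
    using 1 2 by (simp only: add.assoc add.commute[of "h *\<^sub>R b" "h *\<^sub>R a"])
  then have "ga (p + s *\<^sub>R a + t *\<^sub>R b) b = gb (p + s' *\<^sub>R b + t' *\<^sub>R a) a"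
    using h by simp
  moreover have "dist (ga (p + s *\<^sub>R a + t *\<^sub>R b) b) (ga p b) < e"
    using near close st by simp
  moreover have "dist (gb (p + s' *\<^sub>R b + t' *\<^sub>R a) a) (gb p a) < e"
    using near close' st' by simp
  ultimately show False
    by (simp add: e_def dist_real_def abs_if split: if_splits)
qed

text \<open>Pairing with an arbitrary vector \<open>c\<close> reduces this to the real case, where
  the mean value theorem is available.\<close>

lemma symmetric_second_derivative:
  fixes g :: "'a::real_normed_vector \<Rightarrow> 'b::real_inner"
  assumes S: "open S" "p \<in> S"
    and g': "\<And>q. q \<in> S \<Longrightarrow> (g has_derivative g' q) (at q)"
    and ga: "\<And>q. q \<in> S \<Longrightarrow> ((\<lambda>r. g' r a) has_derivative ga q) (at q)"
    and gb: "\<And>q. q \<in> S \<Longrightarrow> ((\<lambda>r. g' r b) has_derivative gb q) (at q)"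
    and cont: "continuous_on S (\<lambda>q. ga q b)" "continuous_on S (\<lambda>q. gb q a)"
  shows "ga p b = gb p a"
proof -
  have "ga p b \<bullet> c = gb p a \<bullet> c" for c
    by (rule symmetric_second_derivative_real[OF S, of "\<lambda>q. g q \<bullet> c" "\<lambda>q v. g' q v \<bullet> c" a
          "\<lambda>q v. ga q v \<bullet> c" b "\<lambda>q v. gb q v \<bullet> c"])
      (auto intro!: has_derivative_inner_left g' ga gb continuous_intros cont)
  then show ?thesis
    by (metis vector_eq_rdot)
qed

section \<open>Smooth maps and their partial derivatives\<close>

lemma smooth_on_imp_has_derivative:
  assumes "smooth_on S f" "p \<in> S"
  shows "(f has_derivative frechet_derivative f (at p)) (at p)"
proof -
  have "higher_differentiable_on S f (Suc 0)"
    using assms(1) unfolding smooth_on_def by blast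
  then show ?thesis
    using assms(2) by (simp add: frechet_derivative_works)
qed

lemma smooth_on_frechet_derivative:
  assumes "smooth_on S f"
  shows "smooth_on S (\<lambda>q. frechet_derivative f (at q) v)"
  unfolding smooth_on_def
proof
  fix k
  have "higher_differentiable_on S f (Suc k)"
    using assms unfolding smooth_on_def by blast
  then show "higher_differentiable_on S (\<lambda>q. frechet_derivative f (at q) v) k"
    by simp
qed

lemma smooth_on_imp_continuous_on: "smooth_on S f \<Longrightarrow> continuous_on S f"
  unfolding smooth_on_def by (metis higher_differentiable_on.simps(1))

lemma partial_eq_frechet_derivative_smooth_on:
  assumes "smooth_on S f" "p \<in> S"
  shows "partial i f p = frechet_derivative f (at p) (axis i 1)"
  by (rule partial_eq_frechet_derivative)
    (rule differentiableI[OF smooth_on_imp_has_derivative[OF assms]])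

text \<open>On the open set \<open>U\<close> the function \<open>partial i f\<close> agrees with a
  directional Frechet derivative of \<open>f\<close>, which is smooth there.\<close>

lemma has_derivative_partial:
  assumes f: "smooth_on U f" and U: "open U" "p \<in> U"
  shows "(partial i f has_derivative
    frechet_derivative (\<lambda>q. frechet_derivative f (at q) (axis i 1)) (at p)) (at p)"
  by (rule has_derivative_transform_within_open[OF
        smooth_on_imp_has_derivative[OF smooth_on_frechet_derivative[OF f] U(2)] U])
    (simp add: partial_eq_frechet_derivative_smooth_on[OF f])

lemma partial_eqI:
  assumes "(f has_derivative f') (at p)"
  shows "partial i f p = f' (axis i 1)"
  using partial_eq_frechet_derivative[of f p i] assms
  by (metis differentiableI frechet_derivative_at)

text \<open>Packages the second partials as axis values of one derivative \<open>D\<close>, the form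
  that fits the product rule.\<close>

lemma has_derivative_partial_expand:
  assumes "smooth_on U f" "open U" "p \<in> U"
  obtains D where "(partial i f has_derivative D) (at p)"
    "\<And>j. D (axis j 1) = partial j (partial i f) p"
  using has_derivative_partial[OF assms] partial_eqI by metis

lemma partial_commute:
  fixes f :: "real^2 \<Rightarrow> 'b::real_inner"
  assumes f: "smooth_on U f" and U: "open U" "p \<in> U"
  shows "partial i (partial j f) p = partial j (partial i f) p"
proof -
  note s = smooth_on_frechet_derivative[OF f]
  have "frechet_derivative (\<lambda>q. frechet_derivative f (at q) (axis j 1)) (at p) (axis i 1)
      = frechet_derivative (\<lambda>q. frechet_derivative f (at q) (axis i 1)) (at p) (axis j 1)"
    by (rule symmetric_second_derivative[OF U, of f "\<lambda>q. frechet_derivative f (at q)"])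
      (auto intro: smooth_on_imp_has_derivative f s smooth_on_imp_continuous_on
        smooth_on_frechet_derivative)
  then show ?thesis
    by (simp add: partial_eqI[OF has_derivative_partial[OF f U]])
qed

section \<open>Orthogonal tangent frames and their differentiation\<close>

text \<open>The difference \<open>d\<close> of the two sides is both orthogonal and parallel to
  \<open>X \<times> Y\<close>, which is nonzero, so \<open>d\<close> vanishes.\<close>

lemma orthogonal_frame_expansion:
  fixes X Y z :: "real^3"
  assumes L: "X \<bullet> X = L" "Y \<bullet> Y = L" "0 < L" and XY: "X \<bullet> Y = 0"
    and z: "z \<bullet> (X \<times> Y) = 0"
  shows "L *\<^sub>R z = (z \<bullet> X) *\<^sub>R X + (z \<bullet> Y) *\<^sub>R Y"
proof -
  define d where "d = L *\<^sub>R z - ((z \<bullet> X) *\<^sub>R X + (z \<bullet> Y) *\<^sub>R Y)"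
  have "Y \<bullet> X = 0"
    using XY by (simp add: inner_commute)
  then have dX: "d \<bullet> X = 0" and dY: "d \<bullet> Y = 0"
    using L XY by (simp_all add: d_def inner_diff_left inner_add_left)
  have dW: "d \<bullet> (X \<times> Y) = 0"
    using z by (simp add: d_def inner_diff_left inner_add_left dot_cross_self)
  \<comment> \<open>The double cross product is a combination of \<open>X\<close> and
    \<open>Y\<close> with coefficients \<open>d \<bullet> Y\<close> and
    \<open>- (d \<bullet> X)\<close>.\<close>
  have "d \<times> (X \<times> Y) = 0"
    using dX dY by (simp add: Lagrange inner_commute)
  then have "norm d * norm (X \<times> Y) = 0"
    using norm_cross_dot[of d "X \<times> Y"] dW by simp
  moreover have "(norm (X \<times> Y))\<^sup>2 = L\<^sup>2"
    using norm_cross_dot[of X Y] L XY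
    by (simp add: power_mult_distrib power2_norm_eq_inner) (simp add: power2_eq_square)
  ultimately have "d = 0"
    using L(3) by auto
  then show ?thesis
    by (simp add: d_def)
qed

text \<open>Differentiate the tangency condition and expand \<open>a p\<close> in the frame:
  \<open>X p\<close> is orthogonal to \<open>X p \<times> Y' w\<close>, and \<open>Y p\<close> to
  \<open>X' w \<times> Y p\<close>, so one triple product survives per frame vector.\<close>

lemma normal_component_of_partial_tangential:
  fixes X Y a :: "real^2 \<Rightarrow> real^3"
  assumes U: "open U" "p \<in> U"
    and tangential: "\<And>q. q \<in> U \<Longrightarrow> a q \<bullet> (X q \<times> Y q) = 0"
    and a: "(a has_derivative a') (at p)"
    and X: "(X has_derivative X') (at p)" and Y: "(Y has_derivative Y') (at p)"
    and L: "X p \<bullet> X p = L" "Y p \<bullet> Y p = L" "0 < L" and XY: "X p \<bullet> Y p = 0"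
  shows "L * (a' w \<bullet> (X p \<times> Y p))
    = (a p \<bullet> X p) * (X' w \<bullet> (X p \<times> Y p)) + (a p \<bullet> Y p) * (Y' w \<bullet> (X p \<times> Y p))"
proof -
  have "bounded_bilinear (\<times>)"
    using bilinear_cross bilinear_conv_bounded_bilinear by blast
  from bounded_bilinear.FDERIV[OF this X Y]
  have "((\<lambda>q. a q \<bullet> (X q \<times> Y q)) has_derivative
      (\<lambda>w. a p \<bullet> (X p \<times> Y' w + X' w \<times> Y p) + a' w \<bullet> (X p \<times> Y p))) (at p)"
    by (rule has_derivative_inner[OF a])
  \<comment> \<open>The triple product vanishes on a whole neighbourhood of \<open>p\<close>, hence
    so does its derivative at \<open>p\<close>.\<close>
  moreover have "((\<lambda>q. a q \<bullet> (X q \<times> Y q)) has_derivative (\<lambda>w. 0)) (at p)"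
    by (rule has_derivative_transform_within_open[OF has_derivative_const U])
      (simp add: tangential)
  ultimately have "(\<lambda>w. a p \<bullet> (X p \<times> Y' w + X' w \<times> Y p) + a' w \<bullet> (X p \<times> Y p)) = (\<lambda>w. 0)"
    by (rule has_derivative_unique)
  then have "a p \<bullet> (X p \<times> Y' w + X' w \<times> Y p) + a' w \<bullet> (X p \<times> Y p) = 0"
    by meson
  then have "a' w \<bullet> (X p \<times> Y p) = - (a p \<bullet> (X p \<times> Y' w + X' w \<times> Y p))"
    by linarith
  then have "L * (a' w \<bullet> (X p \<times> Y p)) = - ((L *\<^sub>R a p) \<bullet> (X p \<times> Y' w + X' w \<times> Y p))"
    by simp
  also have "\<dots> = (a p \<bullet> X p) * (X' w \<bullet> (X p \<times> Y p)) + (a p \<bullet> Y p) * (Y' w \<bullet> (X p \<times> Y p))"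
  proof -
    have "X p \<bullet> (X' w \<times> Y p) = - (X' w \<bullet> (X p \<times> Y p))"
      "Y p \<bullet> (X p \<times> Y' w) = - (Y' w \<bullet> (X p \<times> Y p))"
      by (simp_all add: cross3_simps)
    then show ?thesis
      unfolding orthogonal_frame_expansion[OF L XY tangential[OF U(2)]]
      by (simp add: inner_add_left inner_add_right dot_cross_self)
  qed
  finally show ?thesis .
qed

section \<open>The Darboux equation and the four relations\<close>

text \<open>Pointwise algebra, with \<open>a\<close>, \<open>b\<close> standing for
  \<open>y\<^sub>u\<close>, \<open>y\<^sub>v\<close> and \<open>X\<close>, \<open>Y\<close> for
  \<open>x\<^sub>u\<close>, \<open>x\<^sub>v\<close>. Permuting the triple products and substituting
  the Darboux equation gives products with a repeated factor.\<close>

lemma darboux_cross_identity: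
  fixes a b X Y :: "real^3"
  assumes ab: "a \<times> Y = b \<times> X"
    and L: "X \<bullet> X = L" "Y \<bullet> Y = L" "0 < L" and XY: "X \<bullet> Y = 0"
  shows "a \<bullet> (X \<times> Y) = 0" "b \<bullet> (X \<times> Y) = 0" "a \<bullet> X + b \<bullet> Y = 0"
proof -
  have "a \<bullet> (X \<times> Y) = - (X \<bullet> (b \<times> X))"
    unfolding ab[symmetric] by (simp add: cross3_simps)
  then show "a \<bullet> (X \<times> Y) = 0"
    by (simp add: dot_cross_self)
  have "b \<bullet> (X \<times> Y) = Y \<bullet> (a \<times> Y)"
    unfolding ab by (simp add: cross3_simps)
  then show "b \<bullet> (X \<times> Y) = 0"
    by (simp add: dot_cross_self)
  \<comment> \<open>The Binet-Cauchy identity; orthogonality of \<open>X\<close> and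
    \<open>Y\<close> leaves one term in each product.\<close>
  have "(a \<times> Y) \<bullet> (X \<times> Y) = L * (a \<bullet> X)" "(b \<times> X) \<bullet> (X \<times> Y) = - L * (b \<bullet> Y)"
    using L XY by (simp_all add: dot_cross inner_commute)
  with ab L(3) have "L * (a \<bullet> X + b \<bullet> Y) = 0"
    by (simp add: distrib_left)
  with L(3) show "a \<bullet> X + b \<bullet> Y = 0"
    by simp
qed

theorem theorem1:
  fixes S :: "(real^3) set" and U :: "(real^2) set"
    and x y :: "real^2 \<Rightarrow> real^3"
  assumes "smooth_surface S"
    and "parameterization U x S"
    and "isothermal_on U x"
    and "darboux_rotation_field U x y"
  shows "\<forall>p\<in>U.
      partial_u y p \<bullet> unit_normal x p = 0 \<and>
      partial_v y p \<bullet> unit_normal x p = 0 \<and>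
      partial_u y p \<bullet> partial_u x p + partial_v y p \<bullet> partial_v x p = 0 \<and>
      h21 x p * (partial_u y p \<bullet> partial_u x p) + h22 x p * (partial_u y p \<bullet> partial_v x p)
        - h11 x p * (partial_v y p \<bullet> partial_u x p) - h12 x p * (partial_v y p \<bullet> partial_v x p) = 0"
proof
  fix p
  assume p: "p \<in> U"
  have U: "open U" and x: "smooth_on U x"
    using assms(2) by (simp_all add: parameterization_def)
  have y: "smooth_on U y"
    using assms(4) by (simp add: darboux_rotation_field_def)
  let ?L = "conformal_factor x" and ?X = "partial_u x" and ?Y = "partial_v x"
  have frame: "?X q \<bullet> ?X q = ?L q" "?Y q \<bullet> ?Y q = ?L q" "0 < ?L q" "?X q \<bullet> ?Y q = 0"
    if "q \<in> U" for q
    using assms(3) that by (simp_all add: isothermal_on_def conformal_factor_def)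
  have D: "partial_u y q \<bullet> (?X q \<times> ?Y q) = 0" "partial_v y q \<bullet> (?X q \<times> ?Y q) = 0"
      "partial_u y q \<bullet> ?X q + partial_v y q \<bullet> ?Y q = 0" if "q \<in> U" for q
  proof -
    have "partial_u y q \<times> ?Y q = partial_v y q \<times> ?X q"
      using assms(4) that by (simp add: darboux_rotation_field_def)
    from darboux_cross_identity[OF this frame[OF that]]
    show "partial_u y q \<bullet> (?X q \<times> ?Y q) = 0" "partial_v y q \<bullet> (?X q \<times> ?Y q) = 0"
      "partial_u y q \<bullet> ?X q + partial_v y q \<bullet> ?Y q = 0" .
  qed
  obtain X' where X': "(?X has_derivative X') (at p)" "\<And>j. X' (axis j 1) = partial j ?X p"
    using has_derivative_partial_expand[OF x U p] by blast
  obtain Y' where Y': "(?Y has_derivative Y') (at p)" "\<And>j. Y' (axis j 1) = partial j ?Y p"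
    using has_derivative_partial_expand[OF x U p] by blast
  have second: "?L p * (partial j (partial i y) p \<bullet> (?X p \<times> ?Y p))
      = (partial i y p \<bullet> ?X p) * (partial j ?X p \<bullet> (?X p \<times> ?Y p))
        + (partial i y p \<bullet> ?Y p) * (partial j ?Y p \<bullet> (?X p \<times> ?Y p))"
    if "\<And>q. q \<in> U \<Longrightarrow> partial i y q \<bullet> (?X q \<times> ?Y q) = 0" for i j
  proof -
    obtain a' where a': "(partial i y has_derivative a') (at p)"
      "\<And>j. a' (axis j 1) = partial j (partial i y) p"
      using has_derivative_partial_expand[OF y U p] by blast
    from normal_component_of_partial_tangential[OF U p that a'(1) X'(1) Y'(1) frame[OF p],
        of "axis j 1"]
    show ?thesis
      by (simp add: a' X' Y')
  qed
  \<comment> \<open>Both sides equal \<open>?L p\<close> times the component of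
    \<open>y\<^sub>u\<^sub>v\<close> along \<open>?X p \<times> ?Y p\<close>; symmetry for
    \<open>y\<close> identifies them, and symmetry for \<open>x\<close> replaces
    \<open>partial_u ?Y\<close> by \<open>partial_v ?X\<close>.\<close>
  have "(partial_u y p \<bullet> ?X p) * (partial_v ?X p \<bullet> (?X p \<times> ?Y p))
        + (partial_u y p \<bullet> ?Y p) * (partial_v ?Y p \<bullet> (?X p \<times> ?Y p))
      = (partial_v y p \<bullet> ?X p) * (partial_u ?X p \<bullet> (?X p \<times> ?Y p))
        + (partial_v y p \<bullet> ?Y p) * (partial_v ?X p \<bullet> (?X p \<times> ?Y p))"
    using second[OF D(1), of 2] second[OF D(2), of 1]
    by (simp add: partial_commute[OF y U p, of 1 2] partial_commute[OF x U p, of 1 2])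
  \<comment> \<open>The factor \<open>inverse (?L p)\<close> turns \<open>?X p \<times> ?Y p\<close>
    into the unit normal, hence the triple products into the coefficients of the second fundamental
    form.\<close>
  then have "inverse (?L p) * ((partial_u y p \<bullet> ?X p) * (partial_v ?X p \<bullet> (?X p \<times> ?Y p))
        + (partial_u y p \<bullet> ?Y p) * (partial_v ?Y p \<bullet> (?X p \<times> ?Y p)))
      = inverse (?L p) * ((partial_v y p \<bullet> ?X p) * (partial_u ?X p \<bullet> (?X p \<times> ?Y p))
        + (partial_v y p \<bullet> ?Y p) * (partial_v ?X p \<bullet> (?X p \<times> ?Y p)))"
    by simp
  then have "h21 x p * (partial_u y p \<bullet> ?X p) + h22 x p * (partial_u y p \<bullet> ?Y p)
        - h11 x p * (partial_v y p \<bullet> ?X p) - h12 x p * (partial_v y p \<bullet> ?Y p) = 0"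
    unfolding h11_def h12_def h21_def h22_def unit_normal_def inner_scaleR_right
    by (simp add: algebra_simps)
  then show "partial_u y p \<bullet> unit_normal x p = 0 \<and>
      partial_v y p \<bullet> unit_normal x p = 0 \<and>
      partial_u y p \<bullet> partial_u x p + partial_v y p \<bullet> partial_v x p = 0 \<and>
      h21 x p * (partial_u y p \<bullet> partial_u x p) + h22 x p * (partial_u y p \<bullet> partial_v x p)
        - h11 x p * (partial_v y p \<bullet> partial_u x p) - h12 x p * (partial_v y p \<bullet> partial_v x p) = 0"
    using D[OF p] by (simp add: unit_normal_def)
qed

end
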